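(* Let $q$ be a prime power and let $m\ge 2$, $\ell>0$ be integers such that $\ell\mid m$ and $m/\ell$ is even. Then the spectrum of $\Gamma_{q,m}(\ell)$ consists of integers and is as follows. (a) If $\ell\neq \frac m2$, the distinct eigenvalues are $$k_\ell=\frac{q^m-1}{q^\ell+1},\qquad \upsilon_\ell=\frac{\varepsilon_\ell\, q^{m/2}-1}{q^\ell+1},\qquad \mu_\ell=\frac{-\varepsilon_\ell\, q^{\frac m2+\ell}-1}{q^\ell+1},$$ where $\varepsilon_\ell=(-1)^{\frac12 (m/\ell)}$, with multiplicities $1$, $q^\ell k_\ell$ and $k_\ell$ respectively. (b) If $\ell=\frac m2$, the distinct eigenvalues are $k_{m/2}=q^{m/2}-1$ and $-1$, with multiplicities $q^{m/2}$ and $q^{m/2}(q^{m/2}-1)$ respectively.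
   Context: For a prime power $q$ and integers $m\ge1$, $\ell\ge 0$, let $S_{q,m}(\ell)=\{x^{q^\ell+1}: x\in\mathbb{F}_{q^m}^*\}$. The graph $\Gamma_{q,m}(\ell)$ is the Cayley graph with vertex set $\mathbb{F}_{q^m}$ (as additive group) in which there is an edge from $x$ to $y$ iff $y-x\in S_{q,m}(\ell)$. Eigenvalues and spectrum of a graph are those of its adjacency matrix, counted with multiplicity. *)

theory Defs
  imports
    "HOL-Library.Cardinality"
    "HOL-Number_Theory.Prime_Powers"
    "Graph_Theory.Pair_Digraph"
    "Jordan_Normal_Form.Spectral_Radius"
begin

definition cayley_digraph :: "'a::group_add set \<Rightarrow> 'a pair_pre_digraph" where
  "cayley_digraph S = \<lparr>pverts = UNIV, parcs = {(x, y). y - x \<in> S}\<rparr>"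

definition power_set_S :: "nat \<Rightarrow> nat \<Rightarrow> 'a::field set" where
  "power_set_S q l = {x ^ (q ^ l + 1) | x. x \<noteq> 0}"

text \<open>
  The field with \<open>q ^ m\<close> elements is the type \<open>'a\<close>; the parameter \<open>m\<close> enters through the
  assumption \<open>CARD('a) = q ^ m\<close>.
\<close>

definition Gamma_graph :: "nat \<Rightarrow> nat \<Rightarrow> 'a::field pair_pre_digraph" where
  "Gamma_graph q l = cayley_digraph (power_set_S q l)"

text \<open>
  Matrices are indexed by natural numbers, so an adjacency matrix is taken with respect to a
  list \<open>vs\<close> enumerating the vertices without repetition.
\<close>

definition vertex_enum :: "'a pair_pre_digraph \<Rightarrow> 'a list \<Rightarrow> bool" where
  "vertex_enum G vs \<longleftrightarrow> distinct vs \<and> set vs = pverts G"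

definition adjacency_matrix :: "'a pair_pre_digraph \<Rightarrow> 'a list \<Rightarrow> complex mat" where
  "adjacency_matrix G vs =
     mat (length vs) (length vs) (\<lambda>(i, j). if (vs ! i, vs ! j) \<in> parcs G then 1 else 0)"

text \<open>Algebraic multiplicity.\<close>

definition eig_mult :: "complex mat \<Rightarrow> complex \<Rightarrow> nat" where
  "eig_mult A c = Polynomial.order c (char_poly A)"

text \<open>
  The next definitions are used only when \<open>l dvd m\<close> and \<open>m div l\<close> is even, so all the
  natural-number divisions by \<open>l\<close> and by 2 are exact.
\<close>

definition eps_l :: "nat \<Rightarrow> nat \<Rightarrow> complex" where
  "eps_l m l = (- 1) ^ (m div l div 2)"

definition k_l :: "nat \<Rightarrow> nat \<Rightarrow> nat \<Rightarrow> complex" where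
  "k_l q m l = (of_nat q ^ m - 1) / (of_nat q ^ l + 1)"

definition upsilon_l :: "nat \<Rightarrow> nat \<Rightarrow> nat \<Rightarrow> complex" where
  "upsilon_l q m l = (eps_l m l * of_nat q ^ (m div 2) - 1) / (of_nat q ^ l + 1)"

definition mu_l :: "nat \<Rightarrow> nat \<Rightarrow> nat \<Rightarrow> complex" where
  "mu_l q m l = (- eps_l m l * of_nat q ^ (m div 2 + l) - 1) / (of_nat q ^ l + 1)"

end

theory Submission
  imports Defs "HOL-Number_Theory.Cong"
begin

text \<open>
  Put \<open>Q = q ^ l\<close> and \<open>t = m div l\<close>. The additive characters of the field diagonalise the adjacency
  matrix, so its eigenvalues are the Gauss periods \<open>\<eta> a = (\<Sum>s\<in>S. \<psi> (a * s))\<close> for a nontrivial character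
  \<open>\<psi>\<close>, where \<open>S\<close> is the image of \<open>x \<mapsto> x ^ (Q + 1)\<close> on nonzero \<open>x\<close>. For \<open>a \<noteq> 0\<close> the square of the sum
  \<open>(Q + 1) * \<eta> a + 1\<close> of \<open>\<psi> (a * x ^ (Q + 1))\<close> over all \<open>x\<close> is \<open>Q ^ t\<close> times the size of the radical
  of a hermitian form, hence \<open>Q ^ t\<close> or \<open>Q ^ (t + 2)\<close>, the latter for exactly \<open>card S\<close> values
  of \<open>a\<close>. So \<open>\<eta> a\<close> is rational; being an algebraic integer it is an integer, and reduction modulo
  \<open>Q + 1 > 2\<close> determines the sign of the square root.
\<close>

section \<open>Power maps on finite fields\<close>

text \<open>Multiplication by \<open>x\<close> permutes the nonzero elements, so their product is
  unchanged when each of the \<open>CARD('a) - 1\<close> factors is multiplied by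
  \<open>x\<close>.\<close>

lemma finite_field_power_CARD_minus_1:
  fixes x :: "'a::{field,finite}"
  assumes "x \<noteq> 0"
  shows "x ^ (CARD('a) - 1) = 1"
proof -
  have "(\<Prod>y\<in>UNIV-{0}. x * y) = (\<Prod>y\<in>UNIV-{0}. y)"
    by (rule prod.reindex_bij_witness[of _ "\<lambda>y. y / x" "\<lambda>y. x * y"]) (use assms in auto)
  then have "x ^ (CARD('a) - 1) * \<Prod>(UNIV-{0}) = \<Prod>(UNIV-{0})"
    by (simp add: prod.distrib)
  moreover have "\<Prod>(UNIV-{0::'a}) \<noteq> 0"
    by simp
  ultimately show ?thesis
    by simp
qed

lemma finite_field_card_gt_1: "CARD('a::{field,finite}) > 1"
proof -
  have "card {0, 1::'a} \<le> CARD('a)"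
    by (intro card_mono) auto
  then show ?thesis by simp
qed

lemma card_power_eq_le:
  fixes c :: "'a::field"
  assumes "n > 0"
  shows "card {x. x ^ n = c} \<le> n"
proof -
  define p where "p = monom (1::'a) n - [:c:]"
  have p: "coeff p n = 1"
    using assms by (cases n) (auto simp: p_def)
  then have "p \<noteq> 0" by auto
  have "degree p \<le> n"
    unfolding p_def by (intro degree_diff_le) (auto simp: degree_monom_le)
  moreover have "{x. poly p x = 0} = {x. x ^ n = c}"
    by (auto simp: p_def poly_monom)
  ultimately show ?thesis
    using card_poly_roots_bound[OF \<open>p \<noteq> 0\<close>] by simp
qed

text \<open>
  The polynomial \<open>X ^ (n * d) - 1\<close> splits and equals \<open>X ^ n - 1\<close> times a factor of degree
  \<open>n * d - n\<close>, which leaves at least \<open>n\<close> roots to \<open>X ^ n - 1\<close>.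
\<close>

lemma card_roots_of_unity_finite_field:
  assumes "n * d = CARD('a::{field,finite}) - 1"
  shows "card {x::'a. x ^ n = 1} = n"
proof -
  have pos: "n > 0" "d > 0"
    using assms finite_field_card_gt_1[where ?'a = 'a] by (auto intro!: Nat.gr0I)
  define g where "g = (\<Sum>i<d. monom (1::'a) (n * i))"
  \<comment> \<open>Since \<open>n > 0\<close> the exponents \<open>n * i\<close> are distinct, and
    only \<open>i = d - 1\<close> contributes to the top coefficient.\<close>
  have "coeff g (n * (d - 1)) = (\<Sum>i<d. if i = d - 1 then 1 else 0)"
    unfolding g_def coeff_sum using pos by (intro sum.cong) auto
  also have "\<dots> = 1"
    using pos by simp
  finally have "g \<noteq> 0" by auto
  have "degree g \<le> n * (d - 1)"
    unfolding g_def
  proof (rule degree_sum_le)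
    fix i assume "i \<in> {..<d}"
    then show "degree (monom (1::'a) (n * i)) \<le> n * (d - 1)"
      by (intro order.trans[OF degree_monom_le] mult_left_mono) auto
  qed auto
  then have g: "card {x. poly g x = 0} \<le> n * (d - 1)"
    using card_poly_roots_bound[OF \<open>g \<noteq> 0\<close>] by simp
  have "UNIV - {0} \<subseteq> {x::'a. x ^ n = 1} \<union> {x. poly g x = 0}"
  proof
    fix x :: 'a assume "x \<in> UNIV - {0}"
    then have "(x ^ n) ^ d = 1"
      using finite_field_power_CARD_minus_1[of x] by (simp add: assms flip: power_mult)
    moreover have "poly g x = (\<Sum>i<d. (x ^ n) ^ i)"
      by (simp add: g_def poly_sum poly_monom power_mult)
    ultimately have "(x ^ n - 1) * poly g x = 0"
      using power_diff_1_eq[of "x ^ n" d] by simp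
    then show "x \<in> {x. x ^ n = 1} \<union> {x. poly g x = 0}"
      by auto
  qed
  then have "CARD('a) - 1 \<le> card ({x::'a. x ^ n = 1} \<union> {x. poly g x = 0})"
    using card_mono[of "{x::'a. x ^ n = 1} \<union> {x. poly g x = 0}" "UNIV - {0}"]
    by (simp add: card_Diff_singleton)
  also have "\<dots> \<le> card {x::'a. x ^ n = 1} + n * (d - 1)"
    using card_Un_le[of "{x::'a. x ^ n = 1}" "{x. poly g x = 0}"] g by linarith
  finally have "n \<le> card {x::'a. x ^ n = 1}"
    using pos unfolding assms[symmetric] by (cases d) auto
  with card_power_eq_le[of n "1::'a"] pos show ?thesis by simp
qed

text \<open>The fibre through \<open>x\<close> is the coset \<open>x * {y. y ^ n = 1}\<close> of the
  group of \<open>n\<close>-th roots of unity.\<close>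

lemma card_power_eq_power:
  fixes x :: "'a::{field,finite}"
  assumes "n * d = CARD('a) - 1" and "x \<noteq> 0"
  shows "card {y. y ^ n = x ^ n} = n"
proof -
  have "bij_betw (\<lambda>y. x * y) {y. y ^ n = 1} {y. y ^ n = x ^ n}"
    by (rule bij_betw_byWitness[where f' = "\<lambda>y. y / x"])
      (use assms in \<open>auto simp: power_mult_distrib power_divide\<close>)
  then show ?thesis
    using card_roots_of_unity_finite_field[OF assms(1)] bij_betw_same_card by metis
qed

text \<open>One inclusion is clear. Equality follows by counting: all fibres have \<open>n\<close>
  elements, so the image has \<open>d\<close> elements, as many as there are \<open>d\<close>-th
  roots of unity.\<close>

lemma image_power_finite_field:
  assumes "n * d = CARD('a::{field,finite}) - 1"
  shows "(\<lambda>x::'a. x ^ n) ` (UNIV - {0}) = {y. y ^ d = 1}"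
proof (rule card_subset_eq)
  have pos: "n > 0" "d > 0"
    using assms finite_field_card_gt_1[where ?'a = 'a] by (auto intro!: Nat.gr0I)
  let ?I = "(\<lambda>x::'a. x ^ n) ` (UNIV - {0})"
  show "?I \<subseteq> {y. y ^ d = 1}"
    using finite_field_power_CARD_minus_1 by (auto simp: assms simp flip: power_mult)
  have "n * d = (\<Sum>x\<in>UNIV - {0::'a}. 1)"
    by (simp add: assms)
  also have "\<dots> = (\<Sum>y\<in>?I. \<Sum>x\<in>{x. x \<in> UNIV - {0} \<and> x ^ n = y}. 1)"
    by (rule sum.image_gen) simp
  also have "\<dots> = (\<Sum>y\<in>?I. n)"
  proof (rule sum.cong)
    fix y assume "y \<in> ?I"
    then obtain x where "x \<noteq> 0" "y = x ^ n" by auto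
    moreover from this pos have "{z. z \<in> UNIV - {0} \<and> z ^ n = y} = {z. z ^ n = x ^ n}"
      by (auto simp: power_0_left)
    ultimately show "(\<Sum>x\<in>{x. x \<in> UNIV - {0} \<and> x ^ n = y}. 1) = n"
      using card_power_eq_power[OF assms] by simp
  qed simp
  finally have "card ?I = d"
    using pos by simp
  moreover have "card {y::'a. y ^ d = 1} = d"
    by (rule card_roots_of_unity_finite_field[of d n]) (use assms in \<open>simp add: mult.commute\<close>)
  ultimately show "card ?I = card {y::'a. y ^ d = 1}" by simp
qed simp

lemma card_power_eq:
  fixes y :: "'a::{field,finite}"
  assumes "n * d = CARD('a) - 1" and "y \<noteq> 0"
  shows "card {x. x ^ n = y} = (if y ^ d = 1 then n else 0)"
proof (cases "y ^ d = 1")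
  case True
  then obtain x where "x \<noteq> 0" "x ^ n = y"
    using image_power_finite_field[OF assms(1)] by force
  then show ?thesis
    using card_power_eq_power[OF assms(1), of x] True by auto
next
  case False
  have "n > 0"
    using assms finite_field_card_gt_1[where ?'a = 'a] by (auto intro!: Nat.gr0I)
  have "x ^ n \<noteq> y" for x
  proof
    assume "x ^ n = y"
    moreover from this have "x \<noteq> 0" using assms(2) \<open>n > 0\<close> by (auto simp: power_0_left)
    ultimately show False
      using False image_power_finite_field[OF assms(1)] by blast
  qed
  then show ?thesis using False by simp
qed

text \<open>This converts a character sum of a monomial into a Gauss period: zero is hit once, every
  nonzero \<open>n\<close>-th power \<open>n\<close> times.\<close>

lemma sum_power_finite_field:
  fixes f :: "'a::{field,finite} \<Rightarrow> complex"
  assumes "n * d = CARD('a) - 1"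
  shows "(\<Sum>x\<in>UNIV. f (x ^ n)) = f 0 + of_nat n * (\<Sum>y | y ^ d = 1. f y)"
proof -
  have pos: "n > 0" "d > 0"
    using assms finite_field_card_gt_1[where ?'a = 'a] by (auto intro!: Nat.gr0I)
  have "(\<Sum>x\<in>UNIV. f (x ^ n)) = f 0 + (\<Sum>x\<in>UNIV-{0}. f (x ^ n))"
    using pos by (subst sum.remove[of _ 0]) (auto simp: power_0_left)
  also have "(\<Sum>x\<in>UNIV-{0}. f (x ^ n)) =
      (\<Sum>y\<in>(\<lambda>x. x ^ n) ` (UNIV-{0}). \<Sum>x\<in>{x. x \<in> UNIV - {0} \<and> x ^ n = y}. f (x ^ n))"
    by (rule sum.image_gen) simp
  also have "\<dots> = (\<Sum>y | y ^ d = 1. of_nat n * f y)"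
    unfolding image_power_finite_field[OF assms]
  proof (rule sum.cong)
    fix y :: 'a assume y: "y \<in> {y. y ^ d = 1}"
    with pos have "y \<noteq> 0" by (auto simp: power_0_left)
    with pos have "{x. x \<in> UNIV - {0} \<and> x ^ n = y} = {x. x ^ n = y}"
      by (auto simp: power_0_left)
    then show "(\<Sum>x\<in>{x. x \<in> UNIV - {0} \<and> x ^ n = y}. f (x ^ n)) = of_nat n * f y"
      using card_power_eq[OF assms \<open>y \<noteq> 0\<close>] y by simp
  qed simp
  finally show ?thesis
    by (simp add: sum_distrib_left)
qed

section \<open>Additive characters\<close>

lemma prime_CHAR_finite_field: "prime CHAR('a::{field,finite})"
  by (intro prime_CHAR_semidom finite_imp_CHAR_pos) simp

lemma finite_field_power_CARD:
  fixes x :: "'a::{field,finite}"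
  shows "x ^ CARD('a) = x"
proof (cases "x = 0")
  case False
  have "x ^ CARD('a) = x * x ^ (CARD('a) - 1)"
    using finite_field_card_gt_1[where ?'a = 'a] by (simp flip: power_Suc)
  with False show ?thesis
    using finite_field_power_CARD_minus_1[of x] by simp
qed simp

text \<open>The \<open>p\<close> multiples of 1 are fixed by Frobenius, and \<open>X ^ p - X\<close>
  has at most \<open>p\<close> roots, namely 0 and those of \<open>X ^ (p - 1) - 1\<close>; so there
  are no other fixed points.\<close>

lemma power_CHAR_eq_self:
  fixes z :: "'a::{field,finite}"
  assumes "z ^ CHAR('a) = z"
  shows "\<exists>j. z = of_nat j"
proof -
  let ?p = "CHAR('a)"
  have p: "prime ?p" by (rule prime_CHAR_finite_field)
  then have p1: "?p > 1" by (rule prime_gt_1_nat)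
  have inj: "inj_on (of_nat :: nat \<Rightarrow> 'a) {..<?p}"
    by (auto simp: inj_on_def of_nat_eq_iff_cong_CHAR Cong.cong_def)
  have 1: "(of_nat :: nat \<Rightarrow> 'a) ` {..<?p} \<subseteq> {z. z ^ ?p = z}"
  proof clarify
    fix j
    show "(of_nat j :: 'a) ^ ?p = of_nat j"
      using p1 by (induction j) (simp_all add: freshmans_dream p power_0_left)
  qed
  have "z ^ ?p = z \<longleftrightarrow> z = 0 \<or> z ^ (?p - 1) = 1" for z :: 'a
    using p1 by (cases ?p) (auto simp: power_0_left)
  then have "{z::'a. z ^ ?p = z} = insert 0 {z. z ^ (?p - 1) = 1}"
    by auto
  then have "card {z::'a. z ^ ?p = z} \<le> Suc (card {z::'a. z ^ (?p - 1) = 1})"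
    by (simp add: card_insert_le_m1 card_insert_if)
  also have "\<dots> \<le> card ((of_nat :: nat \<Rightarrow> 'a) ` {..<?p})"
    using card_power_eq_le[of "?p - 1" "1::'a"] p1 card_image[OF inj] by simp
  finally have "(of_nat :: nat \<Rightarrow> 'a) ` {..<?p} = {z. z ^ ?p = z}"
    using 1 by (intro card_seteq) auto
  with assms show ?thesis by blast
qed

text \<open>These properties of the trace character suffice: nontriviality yields orthogonality, and
  Frobenius invariance allows \<open>p\<close>-th powers to be taken inside the argument.\<close>

locale frobenius_character =
  fixes \<psi> :: "'a::{field,finite} \<Rightarrow> complex"
  assumes add: "\<psi> (x + y) = \<psi> x * \<psi> y"
    and zero [simp]: "\<psi> 0 = 1"
    and frobenius: "\<psi> (x ^ CHAR('a)) = \<psi> x"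
    and nontrivial: "\<exists>x. \<psi> x \<noteq> 1"

text \<open>
  The character is \<open>x \<mapsto> e ^ (2 \<pi> i Tr(x) / p)\<close>, where \<open>Tr\<close> is the absolute trace; its degree as
  a polynomial is too small for it to vanish identically.
\<close>

lemma ex_frobenius_character:
  assumes card: "CARD('a::{field,finite}) = CHAR('a) ^ n"
  obtains \<psi> :: "'a::{field,finite} \<Rightarrow> complex" where "frobenius_character \<psi>"
proof -
  let ?p = "CHAR('a)"
  have p: "prime ?p" by (rule prime_CHAR_finite_field)
  then have p1: "?p > 1" by (rule prime_gt_1_nat)
  have n: "n > 0"
    using finite_field_card_gt_1[where ?'a = 'a] card by (auto intro!: Nat.gr0I)
  define tr :: "'a \<Rightarrow> 'a" where "tr x = (\<Sum>i<n. x ^ (?p ^ i))" for x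
  have tr_add: "tr (x + y) = tr x + tr y" for x y
    by (simp add: tr_def sum.distrib freshmans_dream'[OF p refl])
  have tr_0: "tr 0 = 0"
    using p1 by (simp add: tr_def power_0_left)
  \<comment> \<open>Raising the summands to the power \<open>p\<close> permutes them cyclically
    because \<open>x ^ (p ^ n) = x\<close>. This gives both the Frobenius invariance of
    \<open>tr\<close> and that its values lie in the prime field.\<close>
  have shift: "(\<Sum>i<n. x ^ (?p ^ Suc i)) = tr x" for x
  proof -
    have "(\<Sum>i<n. x ^ (?p ^ Suc i)) + x ^ (?p ^ 0) = (\<Sum>i<Suc n. x ^ (?p ^ i))"
      by (subst sum.lessThan_Suc_shift) simp
    also have "\<dots> = tr x + x"
      using finite_field_power_CARD[of x] by (simp add: tr_def card)
    finally show ?thesis by simp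
  qed
  have tr_frobenius: "tr (x ^ ?p) = tr x" for x
    using shift[of x] by (simp add: tr_def flip: power_mult)
  have "tr x ^ ?p = tr x" for x
    using shift[of x] by (simp add: tr_def freshmans_dream_sum[OF p refl] mult.commute flip: power_mult)
  then have "\<exists>j. tr x = of_nat j" for x
    by (rule power_CHAR_eq_self)
  then obtain j where j: "\<And>x. tr x = of_nat (j x)"
    by metis
  define \<psi> where "\<psi> x = cis (2 * pi * real (j x) / real ?p)" for x
  \<comment> \<open>The representatives \<open>j x\<close> are arbitrary, hence not additive; the
    exponential depends only on their residue modulo \<open>p\<close>.\<close>
  have \<psi>_cong: "cis (2 * pi * real a / real ?p) = cis (2 * pi * real b / real ?p)"
    if "(of_nat a :: 'a) = of_nat b" for a b
  proof -
    have *: "cis (2 * pi * real a / real ?p) = cis (2 * pi * real (a mod ?p) / real ?p)" for a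
    proof -
      have "2 * pi * real a / real ?p =
          2 * pi * real (a mod ?p) / real ?p + 2 * pi * real_of_int (int (a div ?p))"
      proof -
        have "real a = real (a div ?p) * real ?p + real (a mod ?p)"
          by (metis div_mult_mod_eq of_nat_add of_nat_mult)
        then show ?thesis
          using p1 by (simp add: field_simps)
      qed
      also have "cis \<dots> = cis (2 * pi * real (a mod ?p) / real ?p)"
        by (subst cis_mult[symmetric], subst cis_multiple_2pi) auto
      finally show ?thesis .
    qed
    have "a mod ?p = b mod ?p"
      using that by (simp add: of_nat_eq_iff_cong_CHAR Cong.cong_def)
    then show ?thesis
      using *[of a] *[of b] by simp
  qed
  have nz: "\<exists>x. tr x \<noteq> 0"
  proof (rule ccontr)
    assume *: "\<not> ?thesis"
    define g where "g = (\<Sum>i<n. monom (1::'a) (?p ^ i))"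
    have "coeff g (?p ^ (n - 1)) = (\<Sum>i<n. if i = n - 1 then 1 else 0)"
      unfolding g_def coeff_sum using p1 by (intro sum.cong) auto
    also have "\<dots> = 1"
      using n by simp
    finally have "g \<noteq> 0" by auto
    have "degree g \<le> ?p ^ (n - 1)"
      unfolding g_def
    proof (rule degree_sum_le)
      fix i assume "i \<in> {..<n}"
      then show "degree (monom (1::'a) (?p ^ i)) \<le> ?p ^ (n - 1)"
        using p1 by (intro order.trans[OF degree_monom_le] power_increasing) auto
    qed auto
    moreover have "{x. poly g x = 0} = UNIV"
      using * by (auto simp: g_def poly_sum poly_monom tr_def)
    ultimately have "?p ^ n \<le> ?p ^ (n - 1)"
      using card_poly_roots_bound[OF \<open>g \<noteq> 0\<close>] card by simp
    with p1 n show False by simp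
  qed
  have "frobenius_character \<psi>"
  proof
    show "\<psi> (x + y) = \<psi> x * \<psi> y" for x y
    proof -
      have "\<psi> x * \<psi> y = cis (2 * pi * real (j x + j y) / real ?p)"
        by (simp add: \<psi>_def cis_mult ring_distribs add_divide_distrib)
      also have "\<dots> = \<psi> (x + y)"
        unfolding \<psi>_def by (rule \<psi>_cong) (simp add: tr_add flip: j)
      finally show ?thesis ..
    qed
    show "\<psi> 0 = 1"
      using \<psi>_cong[of "j 0" 0] by (simp add: \<psi>_def tr_0 flip: j)
    show "\<psi> (x ^ ?p) = \<psi> x" for x
      unfolding \<psi>_def by (rule \<psi>_cong) (simp add: tr_frobenius flip: j)
    from nz obtain x where x: "tr x \<noteq> 0" by blast
    have "\<psi> x \<noteq> 1"
    proof
      assume "\<psi> x = 1"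
      then have "cos (2 * pi * real (j x) / real ?p) = 1"
        by (simp add: \<psi>_def complex_eq_iff)
      then obtain k :: int where "2 * pi * real (j x) / real ?p = of_int k * 2 * pi"
        unfolding cos_one_2pi_int by blast
      then have "real (j x) = of_int k * real ?p"
        using p1 by (simp add: field_simps)
      then have "int (j x) = k * int ?p"
        by (metis of_int_eq_iff of_int_mult of_int_of_nat_eq)
      then have "?p dvd j x"
        by (metis dvd_triv_right int_dvd_int_iff)
      then show False
        using x by (simp add: j of_nat_eq_0_iff_char_dvd)
    qed
    then show "\<exists>x. \<psi> x \<noteq> 1" ..
  qed
  then show ?thesis by (rule that)
qed

context frobenius_character
begin

lemma nonzero [simp]: "\<psi> x \<noteq> 0"
  using add[of x "- x"] by auto

lemma frobenius_power: "\<psi> (x ^ (CHAR('a) ^ d)) = \<psi> x"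
proof (induction d)
  case (Suc d)
  have "\<psi> (x ^ (CHAR('a) ^ Suc d)) = \<psi> ((x ^ (CHAR('a) ^ d)) ^ CHAR('a))"
    by (simp add: mult.commute flip: power_mult)
  with Suc show ?case by (simp only: frobenius)
qed simp

text \<open>Orthogonality: for \<open>a \<noteq> 0\<close>, translating \<open>x\<close> by
  \<open>z / a\<close> with \<open>\<psi> z \<noteq> 1\<close> multiplies the sum by
  \<open>\<psi> z\<close>, so it vanishes.\<close>

lemma sum_mult: "(\<Sum>x\<in>UNIV. \<psi> (a * x)) = (if a = 0 then of_nat CARD('a) else 0)"
proof (cases "a = 0")
  case False
  from nontrivial obtain z where z: "\<psi> z \<noteq> 1" by blast
  have "(\<Sum>x\<in>UNIV. \<psi> (a * x)) = (\<Sum>x\<in>UNIV. \<psi> (a * (x + z / a)))"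
    by (rule sum.reindex_bij_witness[of _ "\<lambda>x. x + z / a" "\<lambda>x. x - z / a"]) auto
  also have "\<dots> = \<psi> z * (\<Sum>x\<in>UNIV. \<psi> (a * x))"
    using False by (simp add: ring_distribs add sum_distrib_left mult.commute)
  finally show ?thesis
    using z False by auto
qed simp

end

section \<open>Hermitian character sums\<close>

text \<open>Here \<open>q\<close> stands for what is \<open>q ^ l\<close> in the final theorem, and
  \<open>t\<close> for \<open>m div l\<close>.\<close>

context
  fixes q t d :: nat
  assumes q: "q = CHAR('a::{field,finite}) ^ d" "d > 0"
    and card: "CARD('a) = q ^ t" and t: "even t"
begin

lemma q_gt_1: "q > 1"
  unfolding q(1) by (intro one_less_power prime_gt_1_nat prime_CHAR_finite_field q(2))

lemma q_square_minus_1: "q ^ 2 - 1 = (q + 1) * (q - 1)"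
  using q_gt_1 by (simp add: power2_eq_square algebra_simps)

lemma q_square_gt: "q ^ 2 > q + 1"
proof -
  have "q + 1 < 2 * q" using q_gt_1 by simp
  also have "2 * q \<le> q * q" using q_gt_1 by (intro mult_right_mono) auto
  finally show ?thesis by (simp add: power2_eq_square)
qed

lemma q_plus_1_cofactor:
  assumes "(q + 1) * k = CARD('a) - 1" and "(q ^ 2 - 1) * e = CARD('a) - 1"
  shows "k = (q - 1) * e"
proof -
  have "(q + 1) * k = (q + 1) * ((q - 1) * e)"
    using assms unfolding q_square_minus_1 by (metis mult.assoc)
  then show ?thesis
    unfolding nat_mult_eq_cancel_disj by auto
qed

lemma power_q_add: "(x + y :: 'a) ^ q = x ^ q + y ^ q"
  by (rule freshmans_dream'[OF prime_CHAR_finite_field q(1)])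

lemma power_q_minus: "(- x :: 'a) ^ q = - (x ^ q)"
  using power_q_add[of x "- x"] q_gt_1 by (simp add: power_0_left eq_neg_iff_add_eq_0 add.commute)

lemma minus_one_power_q_plus_1: "(- 1 :: 'a) ^ (q + 1) = 1"
  by (simp add: power_q_minus)

text \<open>As \<open>t\<close> is even, \<open>q ^ t\<close> is a power of \<open>q ^ 2\<close>, so
  \<open>q ^ 2 - 1\<close> divides \<open>q ^ t - 1\<close>. The geometric sum is taken over the
  integers to avoid truncated subtraction.\<close>

lemma q_plus_1_dvd: "q + 1 dvd CARD('a) - 1"
  and q_square_dvd: "q ^ 2 - 1 dvd CARD('a) - 1"
proof -
  obtain r where r: "t = 2 * r" using t by blast
  have "(int q ^ 2) - 1 dvd (int q ^ 2) ^ r - 1"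
    using power_diff_1_eq[of "int q ^ 2" r] by simp
  then have "int (q ^ 2 - 1) dvd int (CARD('a) - 1)"
    using q_gt_1 by (simp add: card r power_mult of_nat_diff)
  then show *: "q ^ 2 - 1 dvd CARD('a) - 1"
    using int_dvd_int_iff by blast
  then show "q + 1 dvd CARD('a) - 1"
    unfolding q_square_minus_1 by (rule dvd_mult_left)
qed

text \<open>The \<open>q ^ 2 - 1 > q\<close> nonzero elements of the subfield of order
  \<open>q ^ 2\<close> cannot all be roots of \<open>X + X ^ q\<close>. For one that is not,
  \<open>z + z ^ q\<close> is fixed by the \<open>q\<close>-th power map, and dividing
  \<open>z\<close> by it gives \<open>\<theta>\<close>.\<close>

lemma ex_add_power_q_eq_1: "\<exists>\<theta>::'a. \<theta> + \<theta> ^ q = 1"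
proof -
  define g where "g = monom (1::'a) 1 + monom 1 q"
  have "coeff g q = 1"
    using q_gt_1 by (simp add: g_def)
  then have "g \<noteq> 0" by auto
  have "degree g \<le> q"
    unfolding g_def using q_gt_1 by (intro degree_add_le order.trans[OF degree_monom_le]) auto
  then have "card {x. poly g x = 0} \<le> q"
    using card_poly_roots_bound[OF \<open>g \<noteq> 0\<close>] by simp
  moreover have "card {x::'a. x ^ (q ^ 2 - 1) = 1} = q ^ 2 - 1"
    using q_square_dvd card_roots_of_unity_finite_field by (metis dvdE)
  moreover note q_square_gt
  ultimately have "\<not> {x::'a. x ^ (q ^ 2 - 1) = 1} \<subseteq> {x. poly g x = 0}"
    using card_mono[OF poly_roots_finite[OF \<open>g \<noteq> 0\<close>], of "{x::'a. x ^ (q ^ 2 - 1) = 1}"] by auto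
  then obtain z where "z ^ (q ^ 2 - 1) = 1" "poly g z \<noteq> 0"
    by blast
  then have z: "z ^ (q ^ 2 - 1) = 1" "z + z ^ q \<noteq> 0"
    by (simp_all add: g_def poly_monom)
  have "z ^ (q ^ 2) = z * z ^ (q ^ 2 - 1)"
    using q_gt_1 by (simp flip: power_Suc)
  then have "(z + z ^ q) ^ q = z + z ^ q"
    using z by (simp add: power_q_add power2_eq_square power_mult)
  then have "z / (z + z ^ q) + (z / (z + z ^ q)) ^ q = 1"
    using z by (simp add: power_divide flip: add_divide_distrib)
  then show ?thesis ..
qed

text \<open>By the description of \<open>(q + 1)\<close>-th powers it suffices that
  \<open>(- 1) ^ k = 1\<close>. For even \<open>q\<close> the characteristic is 2; for odd
  \<open>q\<close> the cofactor \<open>k\<close> is a multiple of the even number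
  \<open>q - 1\<close>.\<close>

lemma ex_power_q_plus_1_eq_minus_1: "\<exists>\<beta>::'a. \<beta> ^ (q + 1) = - 1"
proof -
  obtain k where k: "(q + 1) * k = CARD('a) - 1"
    using q_plus_1_dvd by (metis dvdE)
  have "(- 1 :: 'a) ^ k = 1"
  proof (cases "even q")
    case True
    have "(1 :: 'a) = - 1"
      using power_q_minus[of 1] True by simp
    then show ?thesis by (metis power_one)
  next
    case False
    obtain e where "(q ^ 2 - 1) * e = CARD('a) - 1"
      using q_square_dvd by (metis dvdE)
    then have "k = (q - 1) * e"
      using k by (intro q_plus_1_cofactor)
    then have "even k" using False by simp
    then show ?thesis by simp
  qed
  then have "- 1 \<in> (\<lambda>x::'a. x ^ (q + 1)) ` (UNIV - {0})"
    unfolding image_power_finite_field[OF k] by simp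
  then obtain \<beta> :: 'a where "- 1 = \<beta> ^ (q + 1)"
    by (rule imageE)
  then show ?thesis
    by (intro exI[of _ \<beta>]) (rule sym)
qed

lemma bij_power_q: "bij (\<lambda>x::'a. x ^ q)"
proof -
  have "x = y" if "x ^ q = y ^ q" for x y :: 'a
  proof -
    have "(x - y) ^ q = 0"
      using that power_q_add[of x "- y"] by (simp add: power_q_minus)
    then show ?thesis by simp
  qed
  then have "inj (\<lambda>x::'a. x ^ q)"
    by (auto simp: inj_def)
  then show ?thesis
    by (simp add: bij_def finite_UNIV_inj_surj)
qed

text \<open>A nonzero \<open>u\<close> in the radical solves
  \<open>u ^ (q ^ 2 - 1) = - 1 / a ^ (q - 1)\<close>. Solutions exist iff the \<open>e\<close>-th
  power of the right side is 1, which reads \<open>a ^ k = (- 1) ^ e\<close> because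
  \<open>k = (q - 1) * e\<close>; then there are \<open>q ^ 2 - 1\<close> of them.\<close>

lemma card_hermitian_radical:
  fixes a :: 'a
  assumes "a \<noteq> 0" and k: "(q + 1) * k = CARD('a) - 1" and e: "(q ^ 2 - 1) * e = CARD('a) - 1"
  shows "card {u. a ^ q * u ^ (q ^ 2) + a * u = 0} = (if a ^ k = (- 1) ^ e then q ^ 2 else 1)"
proof -
  let ?y = "- 1 / a ^ (q - 1)"
  have n: "q ^ 2 - 1 > 0"
    using q_square_gt by simp
  have iff: "a ^ q * u ^ (q ^ 2) + a * u = 0 \<longleftrightarrow> u = 0 \<or> u ^ (q ^ 2 - 1) = ?y" for u
  proof -
    have "u ^ (q ^ 2) = u * u ^ (q ^ 2 - 1)" "a ^ q = a * a ^ (q - 1)"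
      using q_gt_1 by (simp_all flip: power_Suc)
    then have "a ^ q * u ^ (q ^ 2) + a * u = a * u * (a ^ (q - 1) * u ^ (q ^ 2 - 1) + 1)"
      by (simp add: algebra_simps)
    then have "a ^ q * u ^ (q ^ 2) + a * u = 0 \<longleftrightarrow> u = 0 \<or> a ^ (q - 1) * u ^ (q ^ 2 - 1) + 1 = 0"
      using assms(1) by simp
    also have "a ^ (q - 1) * u ^ (q ^ 2 - 1) + 1 = 0 \<longleftrightarrow> u ^ (q ^ 2 - 1) * a ^ (q - 1) = - 1"
      by (simp only: eq_neg_iff_add_eq_0 mult.commute)
    also have "\<dots> \<longleftrightarrow> u ^ (q ^ 2 - 1) = ?y"
      using assms(1) by (simp only: eq_divide_eq power_eq_0_iff if_True if_False simp_thms)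
    finally show ?thesis .
  qed
  then have eq: "{u. a ^ q * u ^ (q ^ 2) + a * u = 0} = insert 0 {u. u ^ (q ^ 2 - 1) = ?y}"
    by auto
  have "?y \<noteq> 0" using assms(1) by simp
  then have "0 \<notin> {u. u ^ (q ^ 2 - 1) = ?y}"
    using n assms(1) by (auto simp: power_0_left)
  then have "card {u. a ^ q * u ^ (q ^ 2) + a * u = 0} = Suc (card {u. u ^ (q ^ 2 - 1) = ?y})"
    unfolding eq by simp
  also have "card {u. u ^ (q ^ 2 - 1) = ?y} = (if ?y ^ e = 1 then q ^ 2 - 1 else 0)"
    by (rule card_power_eq[OF e \<open>?y \<noteq> 0\<close>])
  also have "?y ^ e = 1 \<longleftrightarrow> a ^ k = (- 1) ^ e"
  proof -
    have "k = (q - 1) * e"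
      using k e by (rule q_plus_1_cofactor)
    then have "?y ^ e = (- 1) ^ e / a ^ k"
      by (simp only: power_divide power_mult)
    moreover have "(- 1) ^ e / a ^ k = 1 \<longleftrightarrow> (- 1) ^ e = a ^ k"
      using assms(1) by (subst divide_eq_eq) simp
    ultimately show ?thesis
      by (simp only: eq_commute[of "a ^ k"])
  qed
  finally show ?thesis
    using n by auto
qed

text \<open>The right side is a \<open>(q + 1)\<close>-th root of unity, hence a \<open>k\<close>-th
  power, and its fibre has \<open>k\<close> elements.\<close>

lemma card_power_eq_minus_1_power:
  assumes k: "(q + 1) * k = CARD('a) - 1"
  shows "card {a::'a. a ^ k = (- 1) ^ e} = k"
proof -
  have "((- 1 :: 'a) ^ e) ^ (q + 1) = ((- 1) ^ (q + 1)) ^ e"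
    by (simp only: power_mult[symmetric] mult.commute)
  then have "((- 1 :: 'a) ^ e) ^ (q + 1) = 1"
    by (simp only: minus_one_power_q_plus_1 power_one)
  then show ?thesis
    using card_power_eq[of k "q + 1" "(- 1 :: 'a) ^ e"] k by (simp add: mult.commute)
qed

text \<open>
  Choosing \<open>\<beta> ^ (q + 1) = - 1\<close>, the square of the sum runs over the values of the hermitian form
  \<open>x ^ (q + 1) - y ^ (q + 1)\<close>, which is hyperbolic: the substitution \<open>x = y + u\<close>,
  \<open>y = w - \<theta> * u\<close> with \<open>\<theta> + \<theta> ^ q = 1\<close> turns it into \<open>u ^ q * w + u * w ^ q\<close>.
\<close>

lemma hermitian_sum_square:
  assumes "frobenius_character (\<psi> :: 'a \<Rightarrow> complex)"
  shows "(\<Sum>x\<in>UNIV. \<psi> (a * x ^ (q + 1))) ^ 2 =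
    of_nat CARD('a) * of_nat (card {u. a ^ q * u ^ (q ^ 2) + a * u = 0})"
proof -
  interpret frobenius_character \<psi> by fact
  have frob: "\<psi> (x ^ q) = \<psi> x" for x
    unfolding q by (rule frobenius_power)
  obtain \<theta> :: 'a where \<theta>: "\<theta> + \<theta> ^ q = 1"
    using ex_add_power_q_eq_1 by blast
  obtain \<beta> :: 'a where \<beta>: "\<beta> ^ (q + 1) = - 1"
    using ex_power_q_plus_1_eq_minus_1 by blast
  then have "\<beta> \<noteq> 0" by auto
  let ?T = "\<Sum>x\<in>UNIV. \<psi> (a * x ^ (q + 1))"
  have T: "?T = (\<Sum>y\<in>UNIV. \<psi> (- (a * y ^ (q + 1))))"
  proof -
    have "?T = (\<Sum>y\<in>UNIV. \<psi> (a * (\<beta> * y) ^ (q + 1)))"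
      using \<open>\<beta> \<noteq> 0\<close>
      by (intro sum.reindex_bij_witness[of _ "\<lambda>y. \<beta> * y" "\<lambda>y. y / \<beta>"]) auto
    also have "\<dots> = (\<Sum>y\<in>UNIV. \<psi> (- (a * y ^ (q + 1))))"
      unfolding power_mult_distrib \<beta> by simp
    finally show ?thesis .
  qed
  \<comment> \<open>The terms in \<open>u ^ (q + 1)\<close> have total coefficient
    \<open>1 - \<theta> - \<theta> ^ q = 0\<close>.\<close>
  have form: "(w - \<theta> * u + u) ^ (q + 1) - (w - \<theta> * u) ^ (q + 1) = u ^ q * w + u * w ^ q" for u w
  proof -
    have "\<theta> ^ q = 1 - \<theta>" using \<theta> by (simp add: algebra_simps)
    moreover have "(w - \<theta> * u) ^ q = w ^ q - \<theta> ^ q * u ^ q"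
      using power_q_add[of w "- (\<theta> * u)"] by (simp add: power_q_minus power_mult_distrib)
    ultimately show ?thesis
      by (simp add: power_q_add) (simp add: algebra_simps)
  qed
  \<comment> \<open>Frobenius invariance replaces the term linear in \<open>w\<close> by its
    \<open>q\<close>-th power, so that both terms are multiples of \<open>w ^ q\<close>. As
    \<open>w ^ q\<close> runs over the whole field, orthogonality leaves only the \<open>u\<close>
    in the radical.\<close>
  have lin: "(\<Sum>w\<in>UNIV. \<psi> (a * (u ^ q * w + u * w ^ q))) =
      (if a ^ q * u ^ (q ^ 2) + a * u = 0 then of_nat CARD('a) else 0)" for u
  proof -
    have "\<psi> (a * (u ^ q * w + u * w ^ q)) = \<psi> ((a ^ q * u ^ (q ^ 2) + a * u) * w ^ q)" for w
    proof -
      have "\<psi> (a * (u ^ q * w + u * w ^ q)) = \<psi> ((a * u ^ q * w) ^ q) * \<psi> (a * u * w ^ q)"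
        by (simp add: frob ring_distribs add mult.assoc)
      also have "(a * u ^ q * w) ^ q = a ^ q * u ^ (q ^ 2) * w ^ q"
        by (simp add: power_mult_distrib power2_eq_square power_mult)
      finally show ?thesis
        by (simp add: ring_distribs add)
    qed
    then have "(\<Sum>w\<in>UNIV. \<psi> (a * (u ^ q * w + u * w ^ q))) =
        (\<Sum>w\<in>UNIV. \<psi> ((a ^ q * u ^ (q ^ 2) + a * u) * w ^ q))"
      by simp
    also have "\<dots> = (\<Sum>w\<in>UNIV. \<psi> ((a ^ q * u ^ (q ^ 2) + a * u) * w))"
      by (rule sum.reindex_bij_betw[OF bij_power_q])
    finally show ?thesis by (simp add: sum_mult)
  qed
  have "?T ^ 2 = (\<Sum>y\<in>UNIV. \<psi> (- (a * y ^ (q + 1)))) * ?T"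
    using T by (simp add: power2_eq_square)
  also have "\<dots> = (\<Sum>y\<in>UNIV. \<Sum>x\<in>UNIV. \<psi> (a * (x ^ (q + 1) - y ^ (q + 1))))"
    unfolding sum_product by (simp add: right_diff_distrib mult.commute flip: add)
  also have "\<dots> = (\<Sum>y\<in>UNIV. \<Sum>u\<in>UNIV. \<psi> (a * ((y + u) ^ (q + 1) - y ^ (q + 1))))"
  proof (rule sum.cong[OF refl])
    fix y :: 'a
    show "(\<Sum>x\<in>UNIV. \<psi> (a * (x ^ (q + 1) - y ^ (q + 1)))) =
        (\<Sum>u\<in>UNIV. \<psi> (a * ((y + u) ^ (q + 1) - y ^ (q + 1))))"
      by (rule sum.reindex_bij_witness[of _ "\<lambda>u. y + u" "\<lambda>x. x - y"]) auto
  qed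
  also have "\<dots> = (\<Sum>u\<in>UNIV. \<Sum>y\<in>UNIV. \<psi> (a * ((y + u) ^ (q + 1) - y ^ (q + 1))))"
    by (rule sum.swap)
  also have "\<dots> = (\<Sum>u\<in>UNIV. \<Sum>w\<in>UNIV. \<psi> (a * (u ^ q * w + u * w ^ q)))"
  proof (rule sum.cong[OF refl])
    fix u :: 'a
    have "(\<Sum>y\<in>UNIV. \<psi> (a * ((y + u) ^ (q + 1) - y ^ (q + 1)))) =
        (\<Sum>w\<in>UNIV. \<psi> (a * ((w - \<theta> * u + u) ^ (q + 1) - (w - \<theta> * u) ^ (q + 1))))"
      by (rule sum.reindex_bij_witness[of _ "\<lambda>w. w - \<theta> * u" "\<lambda>y. y + \<theta> * u"]) auto
    then show "(\<Sum>y\<in>UNIV. \<psi> (a * ((y + u) ^ (q + 1) - y ^ (q + 1)))) =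
        (\<Sum>w\<in>UNIV. \<psi> (a * (u ^ q * w + u * w ^ q)))"
      unfolding form .
  qed
  also have "\<dots> = (\<Sum>u | a ^ q * u ^ (q ^ 2) + a * u = 0. of_nat CARD('a))"
    unfolding lin by (simp add: sum.If_cases)
  finally show ?thesis
    by simp
qed

end

section \<open>Spectra of Cayley graphs of finite fields\<close>

text \<open>The matrix is the image of an integer matrix, whose characteristic polynomial is monic
  with integer coefficients.\<close>

lemma algebraic_int_spectrum:
  fixes A :: "complex mat"
  assumes A: "A \<in> carrier_mat n n" and int: "\<And>i j. i < n \<Longrightarrow> j < n \<Longrightarrow> A $$ (i, j) \<in> \<int>"
    and c: "poly (char_poly A) c = 0"
  shows "algebraic_int c"
proof -
  define B where "B = map_mat floor (map_mat Re A)"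
  have B: "B \<in> carrier_mat n n"
    using A by (simp add: B_def)
  have "of_int \<lfloor>Re z\<rfloor> = z" if "z \<in> \<int>" for z
    using that by (auto elim: Ints_cases)
  then have "A = map_mat of_int B"
    using A int by (intro eq_matI) (auto simp: B_def)
  then have "char_poly A = map_poly of_int (char_poly B)"
    using of_int_hom.char_poly_hom[OF B] by simp
  moreover have "lead_coeff (char_poly B) = 1"
    using degree_monic_char_poly[OF B] by simp
  ultimately show ?thesis
    using c by (auto simp: algebraic_int_altdef_ipoly)
qed

text \<open>This turns an algebraic multiplicity into the size of a fibre of the eigenvalue
  map.\<close>

lemma order_prod_linear:
  fixes f :: "'b \<Rightarrow> 'a::idom"
  assumes "finite I"
  shows "Polynomial.order c (\<Prod>i\<in>I. [:- f i, 1:]) = card {i\<in>I. f i = c}"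
  using assms
proof (induction I rule: finite_induct)
  case (insert i I)
  have "Polynomial.order c [:- f i, 1:] = (if f i = c then 1 else 0)"
    using order_power_n_n[of c 1] by (auto intro: order_0I)
  moreover have "(\<Prod>i\<in>I. [:- f i, 1:]) \<noteq> 0"
    using insert.hyps by (subst prod_zero_iff) auto
  then have "[:- f i, 1:] * (\<Prod>i\<in>I. [:- f i, 1:]) \<noteq> 0"
    by (simp only: mult_eq_0_iff) simp
  moreover have "{j \<in> insert i I. f j = c} = (if f i = c then insert i {j\<in>I. f j = c} else {j\<in>I. f j = c})"
    by auto
  ultimately show ?case
    using insert by (simp add: order_mult del: mult_pCons_left)
qed (simp add: order_0I)

context frobenius_character
begin

text \<open>Each character \<open>x \<mapsto> \<psi> (a * x)\<close> is an eigenvector for the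
  eigenvalue \<open>\<Sum>s\<in>S. \<psi> (a * s)\<close>, and together these characters form an
  invertible matrix.\<close>

lemma char_poly_cayley:
  assumes vs: "vertex_enum (cayley_digraph S) vs"
  shows "char_poly (adjacency_matrix (cayley_digraph S) vs) =
    (\<Prod>a\<in>UNIV. [:- (\<Sum>s\<in>S. \<psi> (a * s)), 1:])"
proof -
  let ?n = "length vs"
  let ?A = "adjacency_matrix (cayley_digraph S) vs"
  let ?\<eta> = "\<lambda>a. \<Sum>s\<in>S. \<psi> (a * s)"
  have dist: "distinct vs" and set: "set vs = UNIV"
    using vs by (auto simp: vertex_enum_def cayley_digraph_def)
  have n: "?n = CARD('a)"
    using distinct_card[OF dist] by (simp add: set)
  have bij: "bij_betw ((!) vs) {0..<?n} UNIV"
    using bij_betw_nth[OF dist, of "{0..<?n}"] set by (simp add: lessThan_atLeast0)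
  have reindex: "(\<Sum>k = 0..<?n. f (vs ! k)) = (\<Sum>x\<in>UNIV. f x)" for f :: "'a \<Rightarrow> complex"
    by (rule sum.reindex_bij_betw[OF bij])
  have neq: "vs ! i \<noteq> vs ! j" if "i < ?n" "j < ?n" "i \<noteq> j" for i j
    using that dist by (simp add: nth_eq_iff_index_eq)
  \<comment> \<open>\<open>X\<close> is the character table. \<open>Y\<close>, the table at negated
    arguments divided by the number of vertices, is its inverse by orthogonality.\<close>
  define X where "X = mat ?n ?n (\<lambda>(i, j). \<psi> (vs ! i * vs ! j))"
  define Y where "Y = mat ?n ?n (\<lambda>(i, j). \<psi> (- (vs ! i * vs ! j)) / of_nat ?n)"
  define D where "D = mat ?n ?n (\<lambda>(i, j). if i = j then ?\<eta> (vs ! i) else 0)"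
  have carrier [simp]: "X \<in> carrier_mat ?n ?n" "Y \<in> carrier_mat ?n ?n" "D \<in> carrier_mat ?n ?n"
    "?A \<in> carrier_mat ?n ?n"
    by (simp_all add: X_def Y_def D_def adjacency_matrix_def)
  have npos: "?n > 0"
    by (simp add: n)
  have orth: "(\<Sum>k = 0..<?n. \<psi> (vs ! i * vs ! k) * (\<psi> (- (vs ! k * vs ! j)) / of_nat ?n)) =
      (if i = j then 1 else 0)" if "i < ?n" "j < ?n" for i j
  proof -
    have "(\<Sum>k = 0..<?n. \<psi> (vs ! i * vs ! k) * (\<psi> (- (vs ! k * vs ! j)) / of_nat ?n)) =
        (\<Sum>x\<in>UNIV. \<psi> ((vs ! i - vs ! j) * x)) / of_nat ?n"
      unfolding reindex[of "\<lambda>x. \<psi> (vs ! i * x) * (\<psi> (- (x * vs ! j)) / of_nat ?n)"]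
      by (simp add: sum_divide_distrib algebra_simps flip: add)
    then show ?thesis
      using neq[OF that] npos by (auto simp: sum_mult n)
  qed
  have XY: "X * Y = 1\<^sub>m ?n"
    by (rule eq_matI) (use orth in \<open>auto simp: X_def Y_def scalar_prod_def\<close>)
  then have YX: "Y * X = 1\<^sub>m ?n"
    by (rule mat_mult_left_right_inverse[rotated 2]) simp_all
  have AX: "?A * X = X * D"
  proof (rule eq_matI)
    fix i j assume "i < dim_row (X * D)" "j < dim_col (X * D)"
    then have ij: "i < ?n" "j < ?n"
      by (simp_all add: X_def D_def)
    have "(?A * X) $$ (i, j) =
        (\<Sum>k = 0..<?n. (if vs ! k - vs ! i \<in> S then 1 else 0) * \<psi> (vs ! k * vs ! j))"
      using ij by (simp add: adjacency_matrix_def cayley_digraph_def X_def scalar_prod_def)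
    also have "\<dots> = (\<Sum>x\<in>UNIV. if x - vs ! i \<in> S then \<psi> (x * vs ! j) else 0)"
      unfolding reindex[of "\<lambda>x. (if x - vs ! i \<in> S then 1 else 0) * \<psi> (x * vs ! j)"]
      by (rule sum.cong) auto
    also have "\<dots> = (\<Sum>s\<in>UNIV. if s \<in> S then \<psi> ((vs ! i + s) * vs ! j) else 0)"
      by (rule sum.reindex_bij_witness[of _ "\<lambda>s. vs ! i + s" "\<lambda>x. x - vs ! i"]) auto
    also have "\<dots> = \<psi> (vs ! i * vs ! j) * ?\<eta> (vs ! j)"
      by (simp add: sum.If_cases sum_distrib_left algebra_simps flip: add)
    also have "\<dots> = (X * D) $$ (i, j)"
      using ij by (simp add: X_def D_def scalar_prod_def if_distrib sum.delta' cong: if_cong)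
    finally show "(?A * X) $$ (i, j) = (X * D) $$ (i, j)" .
  qed (simp_all add: X_def D_def adjacency_matrix_def)
  have "?A = ?A * (X * Y)"
    unfolding XY by (rule right_mult_one_mat[symmetric]) (rule carrier)
  also have "\<dots> = ?A * X * Y"
    by (rule assoc_mult_mat[symmetric]) (rule carrier)+
  finally have "?A = X * D * Y"
    unfolding AX .
  then have "similar_mat ?A D"
    unfolding similar_mat_def
    by (intro exI[of _ X] exI[of _ Y] similar_mat_witI[OF XY YX]) (rule carrier | assumption)+
  then have "char_poly ?A = char_poly D"
    by (rule char_poly_similar)
  also have "\<dots> = (\<Prod>a\<leftarrow>diag_mat D. [:- a, 1:])"
    by (rule char_poly_upper_triangular[of D ?n]) (auto simp: D_def)
  also have "diag_mat D = map ?\<eta> vs"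
    by (rule nth_equalityI) (auto simp: diag_mat_def D_def)
  also have "(\<Prod>a\<leftarrow>map ?\<eta> vs. [:- a, 1:]) = (\<Prod>a\<in>set vs. [:- ?\<eta> a, 1:])"
    using prod.distinct_set_conv_list[OF dist, of "\<lambda>a. [:- ?\<eta> a, 1:]"] by (simp add: o_def)
  finally show ?thesis
    by (simp add: set)
qed

end

section \<open>Semiprimitive Gauss periods\<close>

text \<open>Integrality fixes the sign: \<open>- (- q) ^ j\<close> is congruent to \<open>- 1\<close>, not \<open>1\<close>, modulo \<open>q + 1 > 2\<close>.\<close>

lemma algebraic_int_sign:
  fixes x :: complex
  assumes x: "algebraic_int x" and q: "q > 1"
    and square: "((of_nat q + 1) * x + 1) ^ 2 = ((- of_nat q) ^ j) ^ 2"
  shows "x \<in> \<int>" "x = ((- of_nat q) ^ j - 1) / (of_nat q + 1)"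
proof -
  have q1: "of_nat q + 1 \<noteq> (0 :: complex)"
    by (metis of_nat_Suc of_nat_eq_0_iff nat.distinct(2) add.commute)
  from square consider (pos) "(of_nat q + 1) * x + 1 = (- of_nat q) ^ j"
    | (neg) "(of_nat q + 1) * x + 1 = - ((- of_nat q) ^ j)"
    unfolding power2_eq_iff by blast
  note cases = this
  \<comment> \<open>Both signs give a rational value, so \<open>x\<close> is an integer before the
    sign is known; integrality then excludes the second sign.\<close>
  have "x = ((- of_nat q) ^ j - 1) / (of_nat q + 1) \<or> x = (- ((- of_nat q) ^ j) - 1) / (of_nat q + 1)"
  proof (cases rule: cases)
    case pos
    then show ?thesis
      using q1 by (simp add: eq_divide_eq flip: pos)
  next
    case neg
    then show ?thesis
      using q1 by (simp add: eq_divide_eq flip: neg)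
  qed
  then have "x \<in> \<rat>"
    by auto
  with x show "x \<in> \<int>"
    by (rule rational_algebraic_int_is_int)
  then obtain z where z: "x = of_int z"
    by (rule Ints_cases)
  show "x = ((- of_nat q) ^ j - 1) / (of_nat q + 1)"
  proof (cases rule: cases)
    case pos
    then show ?thesis
      using q1 by (simp add: eq_divide_eq flip: pos)
  next
    case neg
    then have "(of_int ((int q + 1) * z + 1) :: complex) = of_int (- ((- int q) ^ j))"
      by (simp add: z)
    then have eq: "(int q + 1) * z + 1 = - ((- int q) ^ j)"
      unfolding of_int_eq_iff .
    have "(- int q) - 1 dvd (- int q) ^ j - 1"
      using power_diff_1_eq[of "- int q" j] by simp
    then have "int q + 1 dvd (- int q) ^ j - 1"
      by (metis minus_dvd_iff minus_diff_eq diff_minus_eq_add add.commute)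
    moreover have "int q + 1 dvd (int q + 1) * z" by simp
    ultimately have "int q + 1 dvd (- int q) ^ j - 1 + (int q + 1) * z"
      by (rule dvd_add)
    also have "(- int q) ^ j - 1 + (int q + 1) * z = - 2"
      using eq by linarith
    finally have "int q + 1 dvd 2" by simp
    then show ?thesis
      using q zdvd_imp_le[of "int q + 1" 2] by simp
  qed
qed

text \<open>The sum over all \<open>x\<close> has square \<open>q ^ t\<close> or
  \<open>q ^ (t + 2)\<close>. Taking \<open>- q\<close> rather than \<open>q\<close> as the base of
  the square root is what makes the sign come out uniformly.\<close>

lemma gauss_period_semiprimitive:
  fixes \<psi> :: "'a::{field,finite} \<Rightarrow> complex" and a :: 'a
  assumes q: "q = CHAR('a) ^ d" "d > 0" and card: "CARD('a) = q ^ t" and t: "even t"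
    and \<psi>: "frobenius_character \<psi>"
    and k: "(q + 1) * k = CARD('a) - 1" and e: "(q ^ 2 - 1) * e = CARD('a) - 1"
    and a: "a \<noteq> 0" and int: "algebraic_int (\<Sum>s | s ^ k = 1. \<psi> (a * s))"
  shows "(\<Sum>s | s ^ k = 1. \<psi> (a * s)) \<in> \<int>"
    and "(\<Sum>s | s ^ k = 1. \<psi> (a * s)) =
      ((- of_nat q) ^ (if a ^ k = (- 1) ^ e then t div 2 + 1 else t div 2) - 1) / (of_nat q + 1)"
proof -
  interpret frobenius_character \<psi> by fact
  let ?\<eta> = "\<Sum>s | s ^ k = 1. \<psi> (a * s)"
  have "(\<Sum>x\<in>UNIV. \<psi> (a * x ^ (q + 1))) = 1 + of_nat (q + 1) * ?\<eta>"
    by (subst sum_power_finite_field[OF k, of "\<lambda>y. \<psi> (a * y)"]) simp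
  then have "((of_nat q + 1) * ?\<eta> + 1) ^ 2 =
      of_nat (q ^ t) * of_nat (if a ^ k = (- 1) ^ e then q ^ 2 else 1)"
    using hermitian_sum_square[OF q card t \<psi>, of a] card_hermitian_radical[OF q card t a k e]
    by (simp add: card algebra_simps)
  also have "\<dots> = ((- of_nat q) ^ (if a ^ k = (- 1) ^ e then t div 2 + 1 else t div 2)) ^ 2"
  proof -
    have "(of_nat q :: complex) ^ t = ((- of_nat q) ^ (t div 2)) ^ 2"
      using t by (simp flip: power_mult)
    then show ?thesis
      by (simp add: power_mult_distrib mult.commute)
  qed
  finally show "?\<eta> \<in> \<int>" and "?\<eta> =
      ((- of_nat q) ^ (if a ^ k = (- 1) ^ e then t div 2 + 1 else t div 2) - 1) / (of_nat q + 1)"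
    using algebraic_int_sign[OF int q_gt_1[OF q card t]] by blast+
qed

text \<open>Translation by 1 permutes the field, so summing all elements shows that
  \<open>CARD('a)\<close> vanishes in it; hence the characteristic divides
  \<open>p ^ n\<close>.\<close>

lemma CHAR_of_card_primepow:
  assumes "prime p" and "CARD('a::{field,finite}) = p ^ n"
  shows "CHAR('a) = p"
proof -
  have "(\<Sum>x\<in>UNIV. x + 1) = (\<Sum>x\<in>UNIV. x :: 'a)"
    by (rule sum.reindex_bij_witness[of _ "\<lambda>x. x - 1" "\<lambda>x. x + 1"]) auto
  then have "of_nat CARD('a) = (0 :: 'a)"
    by (simp add: sum.distrib)
  then have "CHAR('a) dvd p ^ n"
    unfolding assms(2) of_nat_eq_0_iff_char_dvd .
  then have "CHAR('a) dvd p"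
    using prime_dvd_power prime_CHAR_finite_field by blast
  then show ?thesis
    using assms(1) prime_CHAR_finite_field[where ?'a = 'a] by (simp add: primes_dvd_imp_eq)
qed

theorem theorem3p5:
  fixes q m l :: nat and vs :: "'a::{field,finite} list" and A :: "complex mat"
  assumes "primepow q" and "m \<ge> 2" and "l > 0" and "l dvd m" and "even (m div l)"
    and "CARD('a) = q ^ m"
    and "vertex_enum (Gamma_graph q l) vs"
    and "A = adjacency_matrix (Gamma_graph q l) vs"
  shows "spectrum A \<subseteq> \<int> \<and>
    (l \<noteq> m div 2 \<longrightarrow>
       spectrum A = {k_l q m l, upsilon_l q m l, mu_l q m l} \<and>
       distinct [k_l q m l, upsilon_l q m l, mu_l q m l] \<and>
       eig_mult A (k_l q m l) = 1 \<and>
       of_nat (eig_mult A (upsilon_l q m l)) = of_nat q ^ l * k_l q m l \<and>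
       of_nat (eig_mult A (mu_l q m l)) = k_l q m l) \<and>
    (l = m div 2 \<longrightarrow>
       k_l q m l = of_nat q ^ (m div 2) - 1 \<and>
       spectrum A = {k_l q m l, - 1} \<and>
       k_l q m l \<noteq> - 1 \<and>
       eig_mult A (k_l q m l) = q ^ (m div 2) \<and>
       eig_mult A (- 1) = q ^ (m div 2) * (q ^ (m div 2) - 1))"
proof -
  define Q where "Q = q ^ l"
  define r where "r = m div l div 2"
  define t where "t = m div l"
  have t: "t = 2 * r" "even t"
    using assms(5) by (simp_all add: t_def r_def)
  have m: "m = l * t"
    using assms(4) by (simp add: t_def)
  have r: "r > 0"
    using assms(2) m t by (auto intro!: Nat.gr0I)
  have m2: "m div 2 = l * r"
    using m t by simp
  obtain p n where p: "prime p" "n > 0" "q = p ^ n"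
    using assms(1) by (auto simp: primepow_def)
  have char: "CHAR('a) = p"
    by (rule CHAR_of_card_primepow[OF p(1), of "n * m"]) (simp add: assms(6) p(3) power_mult)
  have Q: "Q = CHAR('a) ^ (n * l)" "n * l > 0"
    using p(2,3) assms(3) by (simp_all add: Q_def char power_mult)
  have card: "CARD('a) = Q ^ t"
    by (simp add: assms(6) Q_def m power_mult)
  note Q1 = q_gt_1[OF Q card t(2)]
  obtain k where k: "(Q + 1) * k = CARD('a) - 1"
    using q_plus_1_dvd[OF Q card t(2)] by (metis dvdE)
  obtain e where e: "(Q ^ 2 - 1) * e = CARD('a) - 1"
    using q_square_dvd[OF Q card t(2)] by (metis dvdE)
  have k_pos: "k > 0"
    using k finite_field_card_gt_1[where ?'a = 'a] by (auto intro!: Nat.gr0I)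
  obtain \<psi> :: "'a \<Rightarrow> complex" where \<psi>: "frobenius_character \<psi>"
    by (rule ex_frobenius_character[where ?'a = 'a and n = "n * m"]) (simp add: assms(6) char p(3) power_mult)
  interpret frobenius_character \<psi> by fact

  define S where "S = {s::'a. s ^ k = 1}"
  define \<eta> where "\<eta> a = (\<Sum>s\<in>S. \<psi> (a * s))" for a
  define \<kappa> where "\<kappa> = (of_nat k :: complex)"
  \<comment> \<open>The sign \<open>eps_l m l = (- 1) ^ r\<close> is absorbed into the powers of
    \<open>- Q\<close> in \<open>\<upsilon>\<close> and \<open>\<mu>\<close>.\<close>
  define \<upsilon> where "\<upsilon> = ((- of_nat Q) ^ r - 1) / (of_nat Q + 1 :: complex)"
  define \<mu> where "\<mu> = ((- of_nat Q) ^ (r + 1) - 1) / (of_nat Q + 1 :: complex)"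
  \<comment> \<open>\<open>E\<close> collects the \<open>a\<close> whose hermitian form has the
    large radical, of size \<open>Q ^ 2\<close>; these give the value \<open>\<mu>\<close>.\<close>
  define E where "E = {a::'a. a ^ k = (- 1) ^ e}"

  \<comment> \<open>The spectrum as the set of Gauss periods\<close>
  have S: "power_set_S q l = S"
    using image_power_finite_field[OF k] by (auto simp: power_set_S_def S_def Q_def)
  have A: "A = adjacency_matrix (cayley_digraph S) vs" and vs: "vertex_enum (cayley_digraph S) vs"
    using assms(7,8) by (simp_all add: Gamma_graph_def S)
  have char_poly: "char_poly A = (\<Prod>a\<in>UNIV. [:- \<eta> a, 1:])"
    unfolding A \<eta>_def by (rule char_poly_cayley[OF vs])
  have dim: "A \<in> carrier_mat (length vs) (length vs)"
    by (simp add: A adjacency_matrix_def)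
  have mult: "eig_mult A c = card {a. \<eta> a = c}" for c
    by (simp add: eig_mult_def char_poly order_prod_linear)
  have spectrum: "spectrum A = range \<eta>"
    by (auto simp: spectrum_root_char_poly[OF dim] char_poly poly_prod)
  have algebraic: "algebraic_int (\<eta> a)" for a
  proof (rule algebraic_int_spectrum[OF dim])
    show "poly (char_poly A) (\<eta> a) = 0"
      by (auto simp: char_poly poly_prod)
  qed (auto simp: A adjacency_matrix_def)

  have "card S = k"
    unfolding S_def by (rule card_roots_of_unity_finite_field[of k "Q + 1"]) (use k in \<open>simp add: mult.commute\<close>)
  then have \<eta>_0: "\<eta> 0 = \<kappa>"
    by (simp add: \<eta>_def \<kappa>_def)
  have \<eta>_nz: "\<eta> a \<in> \<int>" "\<eta> a = (if a \<in> E then \<mu> else \<upsilon>)" if "a \<noteq> 0" for a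
    using gauss_period_semiprimitive[OF Q card t(2) \<psi> k e that] algebraic[of a] t
    by (auto simp: \<eta>_def S_def E_def \<mu>_def \<upsilon>_def)
  have "\<eta> a \<in> \<int>" for a
    using \<eta>_nz(1)[of a] \<eta>_0 by (cases "a = 0") (auto simp: \<kappa>_def)
  then have ints: "spectrum A \<subseteq> \<int>"
    using spectrum by auto

  \<comment> \<open>Sizes of the fibres of the Gauss periods\<close>
  have E_0: "0 \<notin> E"
    using k_pos by (simp add: E_def power_0_left)
  have card_E: "card E = k"
    unfolding E_def by (rule card_power_eq_minus_1_power[OF Q card t(2) k])
  have "card (- insert 0 E) = CARD('a) - Suc k"
    using E_0 by (simp add: Compl_eq_Diff_UNIV card_Diff_subset card_E)
  also have "\<dots> = Q * k"
    using k by simp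
  finally have card_rest: "card (- insert 0 E) = Q * k" .
  \<comment> \<open>Nonemptiness ensures that both \<open>\<mu>\<close> and
    \<open>\<upsilon>\<close> are attained.\<close>
  have "E \<noteq> {}" "- insert 0 E \<noteq> {}"
    using card_E card_rest k_pos Q1 by auto
  then obtain a b where ab: "a \<in> E" "b \<noteq> 0" "b \<notin> E"
    by auto
  have range: "range \<eta> = {\<kappa>, \<upsilon>, \<mu>}"
  proof
    show "range \<eta> \<subseteq> {\<kappa>, \<upsilon>, \<mu>}"
      using \<eta>_0 \<eta>_nz(2) by (metis image_subsetI insertCI)
    have "\<eta> a = \<mu>" "\<eta> b = \<upsilon>"
      using ab E_0 \<eta>_nz(2) by metis+
    then show "{\<kappa>, \<upsilon>, \<mu>} \<subseteq> range \<eta>"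
      using \<eta>_0 by (auto intro: range_eqI[OF sym])
  qed

  \<comment> \<open>Coincidences among the three values\<close>
  have Q_nz: "of_nat Q + 1 \<noteq> (0 :: complex)"
    by (metis of_nat_Suc of_nat_eq_0_iff nat.distinct(2) add.commute)
  have \<kappa>: "\<kappa> = (of_nat Q ^ t - 1) / (of_nat Q + 1)"
  proof -
    have "of_nat ((Q + 1) * k) = (of_nat (CARD('a) - 1) :: complex)"
      using k by (rule arg_cong)
    then have "(of_nat Q + 1) * \<kappa> = of_nat Q ^ t - 1"
      using Q1 by (simp add: \<kappa>_def card of_nat_diff algebra_simps)
    then show ?thesis
      using Q_nz by (simp add: eq_divide_eq mult.commute)
  qed
  \<comment> \<open>Powers with different exponents already differ in absolute value, whatever their
    signs.\<close>
  have power_neq: "(- of_nat Q :: complex) ^ i \<noteq> (- of_nat Q) ^ j"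
    "(of_nat Q :: complex) ^ i \<noteq> (- of_nat Q) ^ j" if "i \<noteq> j" for i j
  proof -
    have "real Q ^ i \<noteq> real Q ^ j"
      using that Q1 by simp
    moreover have "norm ((- of_nat Q :: complex) ^ i) = real Q ^ i"
      "norm ((of_nat Q :: complex) ^ i) = real Q ^ i" for i
      by (simp_all add: norm_power)
    ultimately show "(- of_nat Q :: complex) ^ i \<noteq> (- of_nat Q) ^ j"
      "(of_nat Q :: complex) ^ i \<noteq> (- of_nat Q) ^ j"
      by metis+
  qed
  have \<mu>_\<upsilon>: "\<mu> \<noteq> \<upsilon>"
    using power_neq(1)[of "r + 1" r] Q_nz by (simp add: \<mu>_def \<upsilon>_def)
  have \<kappa>_\<upsilon>: "\<kappa> \<noteq> \<upsilon>"
    using power_neq(2)[of t r] Q_nz t r by (simp add: \<kappa> \<upsilon>_def)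
  \<comment> \<open>Only \<open>\<upsilon> \<noteq> \<kappa>\<close> and
    \<open>\<upsilon> \<noteq> \<mu>\<close> enter, so this count serves both cases of the
    theorem.\<close>
  have mult_\<upsilon>: "card {a. \<eta> a = \<upsilon>} = Q * k"
  proof -
    have "\<eta> a = \<upsilon> \<longleftrightarrow> a \<in> - insert 0 E" for a
      using \<eta>_0 \<eta>_nz(2)[of a] \<kappa>_\<upsilon> \<mu>_\<upsilon> by (cases "a = 0") auto
    then have "{a. \<eta> a = \<upsilon>} = - insert 0 E"
      by blast
    then show ?thesis
      using card_rest by simp
  qed

  have k_l: "k_l q m l = \<kappa>"
    by (simp add: k_l_def \<kappa> Q_def m power_mult)
  have ups: "upsilon_l q m l = \<upsilon>"
    by (simp add: upsilon_l_def eps_l_def \<upsilon>_def Q_def m2 power_mult power_minus[of "_ ^ l"] flip: r_def)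
  have mu: "mu_l q m l = \<mu>"
    by (simp add: mu_l_def eps_l_def \<mu>_def Q_def m2 power_mult power_add power_minus[of "_ ^ l"] mult.commute flip: r_def)

  \<comment> \<open>Since \<open>\<kappa>\<close> and \<open>\<mu>\<close> involve the exponents
    \<open>2 * r\<close> and \<open>r + 1\<close>, they are distinct as soon as
    \<open>r \<noteq> 1\<close>.\<close>
  have a: "distinct [\<kappa>, \<upsilon>, \<mu>] \<and> card {a. \<eta> a = \<kappa>} = 1 \<and> card {a. \<eta> a = \<mu>} = k" if "l \<noteq> m div 2"
  proof -
    have "r \<noteq> 1"
      using that m2 by auto
    then have "\<kappa> \<noteq> \<mu>"
      using power_neq(2)[of t "r + 1"] Q_nz t by (simp add: \<kappa> \<mu>_def)
    moreover from this have "\<eta> a = \<kappa> \<longleftrightarrow> a = 0" for a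
      using \<eta>_0 \<eta>_nz(2)[of a] \<kappa>_\<upsilon> by (cases "a = 0") auto
    moreover from \<open>\<kappa> \<noteq> \<mu>\<close> have "\<eta> a = \<mu> \<longleftrightarrow> a \<in> E" for a
      using \<eta>_0 \<eta>_nz(2)[of a] \<mu>_\<upsilon> E_0 by (cases "a = 0") auto
    ultimately show ?thesis
      using \<mu>_\<upsilon> \<kappa>_\<upsilon> card_E by auto
  qed
  \<comment> \<open>For \<open>r = 1\<close> both exponents equal 2, so \<open>\<mu>\<close> merges
    with \<open>\<kappa>\<close>, and the multiplicities 1 and \<open>k = Q - 1\<close> add up to
    \<open>Q\<close>.\<close>
  have b: "k = Q - 1 \<and> \<mu> = \<kappa> \<and> \<upsilon> = - 1 \<and> card {a. \<eta> a = \<kappa>} = Q" if "l = m div 2"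
  proof -
    have "r = 1"
      using that m2 assms(3) by auto
    have "(Q + 1) * k = (Q + 1) * (Q - 1)"
      using k q_square_minus_1[OF Q card t(2)] \<open>r = 1\<close> t by (simp add: card)
    then have k_eq: "k = Q - 1"
      unfolding nat_mult_eq_cancel_disj by auto
    have "\<mu> = \<kappa>"
      using \<open>r = 1\<close> t by (simp add: \<mu>_def \<kappa> power2_eq_square)
    moreover have "\<upsilon> = - 1"
      using \<open>r = 1\<close> Q_nz by (simp add: \<upsilon>_def divide_eq_eq)
    moreover have "\<eta> a = \<kappa> \<longleftrightarrow> a \<in> insert 0 E" for a
      using \<eta>_0 \<eta>_nz(2)[of a] \<kappa>_\<upsilon> \<open>\<mu> = \<kappa>\<close> by (cases "a = 0") auto
    then have "{a. \<eta> a = \<kappa>} = insert 0 E"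
      by blast
    then have "card {a. \<eta> a = \<kappa>} = Suc k"
      using E_0 card_E by simp
    ultimately show ?thesis
      using k_eq Q1 by simp
  qed
  have \<kappa>_b: "\<kappa> = of_nat q ^ (m div 2) - 1" if "l = m div 2"
    using b[OF that] Q1 that by (simp add: \<kappa>_def of_nat_diff Q_def)
  show ?thesis
    unfolding k_l ups mu mult spectrum range
  proof (intro conjI impI)
    show "{\<kappa>, \<upsilon>, \<mu>} \<subseteq> \<int>"
      using ints by (simp only: spectrum range)
  next
    assume l: "l = m div 2"
    show "card {a. \<eta> a = - 1} = q ^ (m div 2) * (q ^ (m div 2) - 1)"
      using mult_\<upsilon> b[OF l] l by (simp add: Q_def)
  qed (use a b \<kappa>_b mult_\<upsilon> \<kappa>_\<upsilon> in \<open>auto simp: Q_def \<kappa>_def\<close>)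
qed

end
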